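(* For any integers $3\le c\le d$, there is no $k\in\mathbb{N}$ such that $\mathrm{SA}^k$ solves $\mathrm{PCSP}(\mathbf{K}_c,\mathbf{K}_d)$.
   Context: A signature $\sigma$ is a finite set of relation symbols with arities; a $\sigma$-structure $\mathbf{A}$ has a domain $A$ and relations $R^{\mathbf{A}}\subseteq A^{\mathrm{ar}(R)}$; a homomorphism $\mathbf{X}\to\mathbf{A}$ is a map preserving all relations (coordinatewise). $\mathbf{K}_p$ is the structure with domain $[p]$ and a single binary relation $\{(a,b)\in[p]^2:a\neq b\}$. For $\mathbf{x}=(x_1,\dots,x_r)$, $\{\mathbf{x}\}=\{x_1,\dots,x_r\}$. Sherali-Adams: for finite $\sigma$-structures $\mathbf{X},\mathbf{A}$ and $k\in\mathbb{N}$, introduce variables $\lambda_V(f)$ for each $V\subseteq X$ with $1\le|V|\le k$ and $f:V\to A$, and $\lambda_{R,\mathbf{x}}(f)$ for each $R\in\sigma$, $\mathbf{x}\in R^{\mathbf{X}}$, $f:\{\mathbf{x}\}\to A$. Constraints: (SA1) $\sum_{f:V\to A}\lambda_V(f)=1$ for all $V$ with $1\le|V|\le k$; (SA2) $\lambda_U(f)=\sum_{g:V\to A,\,g|_U=f}\lambda_V(g)$ for $U\subseteq V\subseteq X$, $1\le|U|$, $|V|\le k$, $f:U\to A$; (SA3) $\lambda_U(f)=\sum_{g:\{\mathbf{x}\}\to A,\,g|_U=f}\lambda_{R,\mathbf{x}}(g)$ for $R\in\sigma$, $\mathbf{x}\in R^{\mathbf{X}}$, $U\subseteq\{\mathbf{x}\}$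 with $1\le|U|\le k$, $f:U\to A$; (SA4) $\lambda_{R,\mathbf{x}}(f)=0$ whenever $f(\mathbf{x})\notin R^{\mathbf{A}}$. $\mathrm{SA}^k(\mathbf{X},\mathbf{A})$ accepts if this system has a solution with all variables real in $[0,1]$. For a PCSP template $(\mathbf{A},\mathbf{B})$ (i.e. $\mathbf{A}\to\mathbf{B}$), $\mathrm{SA}^k$ solves $\mathrm{PCSP}(\mathbf{A},\mathbf{B})$ if for every finite $\sigma$-structure $\mathbf{X}$: (i) if $\mathbf{X}\to\mathbf{A}$ then $\mathrm{SA}^k(\mathbf{X},\mathbf{A})$ accepts, and (ii) if $\mathrm{SA}^k(\mathbf{X},\mathbf{A})$ accepts then $\mathbf{X}\to\mathbf{B}$. *)

theory Defs
  imports Complex_Main "HOL-Library.FuncSet"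
begin

section \<open>Relational structures\<close>

record 'r signature =
  syms :: "'r set"
  arity :: "'r \<Rightarrow> nat"

text \<open>Tuples are lists; the length condition is part of \<open>is_structure\<close> below.\<close>

record ('r, 'a) rel_structure =
  domain :: "'a set"
  rel :: "'r \<Rightarrow> 'a list set"

definition is_signature :: "'r signature \<Rightarrow> bool" where
  "is_signature \<sigma> \<longleftrightarrow> finite (syms \<sigma>)"

definition is_structure :: "'r signature \<Rightarrow> ('r, 'a) rel_structure \<Rightarrow> bool" where
  "is_structure \<sigma> \<A> \<longleftrightarrow>
     (\<forall>R\<in>syms \<sigma>. \<forall>t\<in>rel \<A> R. length t = arity \<sigma> R \<and> set t \<subseteq> domain \<A>)"

definition is_finite_structure :: "'r signature \<Rightarrow> ('r, 'a) rel_structure \<Rightarrow> bool" where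
  "is_finite_structure \<sigma> \<A> \<longleftrightarrow> is_structure \<sigma> \<A> \<and> finite (domain \<A>)"

definition is_hom ::
  "'r signature \<Rightarrow> ('r, 'x) rel_structure \<Rightarrow> ('r, 'a) rel_structure \<Rightarrow> ('x \<Rightarrow> 'a) \<Rightarrow> bool" where
  "is_hom \<sigma> \<X> \<A> h \<longleftrightarrow>
     h \<in> domain \<X> \<rightarrow> domain \<A> \<and>
     (\<forall>R\<in>syms \<sigma>. \<forall>t\<in>rel \<X> R. map h t \<in> rel \<A> R)"

definition hom_exists ::
  "'r signature \<Rightarrow> ('r, 'x) rel_structure \<Rightarrow> ('r, 'a) rel_structure \<Rightarrow> bool" where
  "hom_exists \<sigma> \<X> \<A> \<longleftrightarrow> (\<exists>h. is_hom \<sigma> \<X> \<A> h)"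

definition pcsp_template ::
  "'r signature \<Rightarrow> ('r, 'a) rel_structure \<Rightarrow> ('r, 'b) rel_structure \<Rightarrow> bool" where
  "pcsp_template \<sigma> \<A> \<B> \<longleftrightarrow>
     is_signature \<sigma> \<and> is_finite_structure \<sigma> \<A> \<and> is_finite_structure \<sigma> \<B> \<and> hom_exists \<sigma> \<A> \<B>"

section \<open>The Sherali-Adams system\<close>

text \<open>Maps \<open>V \<rightarrow> A\<close> are represented extensionally, as elements of \<open>V \<rightarrow>\<^sub>E A\<close>, so that
  they correspond one-to-one to the indices of the variables. The values of \<open>lv\<close> and \<open>lr\<close>
  at other arguments play no role.\<close>

definition sa_solution ::
  "'r signature \<Rightarrow> nat \<Rightarrow> ('r, 'x) rel_structure \<Rightarrow> ('r, 'a) rel_structure \<Rightarrow>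
   ('x set \<Rightarrow> ('x \<Rightarrow> 'a) \<Rightarrow> real) \<Rightarrow> ('r \<Rightarrow> 'x list \<Rightarrow> ('x \<Rightarrow> 'a) \<Rightarrow> real) \<Rightarrow> bool" where
  "sa_solution \<sigma> k \<X> \<A> lv lr \<longleftrightarrow>
     \<comment> \<open>all variables take values in the unit interval\<close>
     (\<forall>V f. V \<subseteq> domain \<X> \<and> 1 \<le> card V \<and> card V \<le> k \<and> f \<in> V \<rightarrow>\<^sub>E domain \<A> \<longrightarrow>
        0 \<le> lv V f \<and> lv V f \<le> 1) \<and>
     (\<forall>R x f. R \<in> syms \<sigma> \<and> x \<in> rel \<X> R \<and> f \<in> set x \<rightarrow>\<^sub>E domain \<A> \<longrightarrow>
        0 \<le> lr R x f \<and> lr R x f \<le> 1) \<and>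
     \<comment> \<open>SA1\<close>
     (\<forall>V. V \<subseteq> domain \<X> \<and> 1 \<le> card V \<and> card V \<le> k \<longrightarrow>
        (\<Sum>f\<in>V \<rightarrow>\<^sub>E domain \<A>. lv V f) = 1) \<and>
     \<comment> \<open>SA2\<close>
     (\<forall>U V f. U \<subseteq> V \<and> V \<subseteq> domain \<X> \<and> 1 \<le> card U \<and> card V \<le> k \<and> f \<in> U \<rightarrow>\<^sub>E domain \<A> \<longrightarrow>
        lv U f = (\<Sum>g | g \<in> V \<rightarrow>\<^sub>E domain \<A> \<and> restrict g U = f. lv V g)) \<and>
     \<comment> \<open>SA3\<close>
     (\<forall>R x U f. R \<in> syms \<sigma> \<and> x \<in> rel \<X> R \<and> U \<subseteq> set x \<and> 1 \<le> card U \<and> card U \<le> k \<and>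
          f \<in> U \<rightarrow>\<^sub>E domain \<A> \<longrightarrow>
        lv U f = (\<Sum>g | g \<in> set x \<rightarrow>\<^sub>E domain \<A> \<and> restrict g U = f. lr R x g)) \<and>
     \<comment> \<open>SA4\<close>
     (\<forall>R x f. R \<in> syms \<sigma> \<and> x \<in> rel \<X> R \<and> f \<in> set x \<rightarrow>\<^sub>E domain \<A> \<and> map f x \<notin> rel \<A> R \<longrightarrow>
        lr R x f = 0)"

definition sa_accepts ::
  "'r signature \<Rightarrow> nat \<Rightarrow> ('r, 'x) rel_structure \<Rightarrow> ('r, 'a) rel_structure \<Rightarrow> bool" where
  "sa_accepts \<sigma> k \<X> \<A> \<longleftrightarrow> (\<exists>lv lr. sa_solution \<sigma> k \<X> \<A> lv lr)"

text \<open>Instances range over finite structures with domain in \<open>nat\<close>; every finite structure is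
  isomorphic to one of these, and both acceptance and the existence of homomorphisms are
  isomorphism-invariant. The definition is meant for templates \<open>(\<A>, \<B>)\<close>.\<close>

definition sa_solves_pcsp ::
  "'r signature \<Rightarrow> nat \<Rightarrow> ('r, 'a) rel_structure \<Rightarrow> ('r, 'b) rel_structure \<Rightarrow> bool" where
  "sa_solves_pcsp \<sigma> k \<A> \<B> \<longleftrightarrow>
     (\<forall>\<X> :: ('r, nat) rel_structure. is_finite_structure \<sigma> \<X> \<longrightarrow>
        (hom_exists \<sigma> \<X> \<A> \<longrightarrow> sa_accepts \<sigma> k \<X> \<A>) \<and>
        (sa_accepts \<sigma> k \<X> \<A> \<longrightarrow> hom_exists \<sigma> \<X> \<B>))"

section \<open>Cliques\<close>

definition digraph_sig :: "unit signature" where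
  "digraph_sig = \<lparr>syms = {()}, arity = (\<lambda>_. 2)\<rparr>"

definition clique :: "nat \<Rightarrow> (unit, nat) rel_structure" where
  "clique p = \<lparr>domain = {1..p},
     rel = (\<lambda>_. {[a, b] | a b. a \<in> {1..p} \<and> b \<in> {1..p} \<and> a \<noteq> b})\<rparr>"

lemma pcsp_template_clique:
  assumes "c \<le> d"
  shows "pcsp_template digraph_sig (clique c) (clique d)"
proof -
  have "is_hom digraph_sig (clique c) (clique d) id"
    using assms by (auto simp: is_hom_def digraph_sig_def clique_def)
  then show ?thesis
    by (auto simp: pcsp_template_def is_signature_def is_finite_structure_def is_structure_def
        hom_exists_def digraph_sig_def clique_def)
qed

end

theory Submission
  imports Defs "HOL-Library.Nat_Bijection"
begin

text \<open>
  An injection of a vertex set \<open>V\<close> into \<open>m\<close> colours, chosen uniformly at random, restricts to a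
  uniformly random injection of any subset of \<open>V\<close>. Hence \<open>SA\<^sup>k\<close> accepts arbitrarily large cliques as
  instances of \<open>m\<close>-colouring as long as \<open>k \<le> m\<close>. To bring the number of colours down to 3 one replaces
  cliques by their iterated arc graphs, whose vertices are walks of length \<open>r\<close> in the clique: a
  random injection acts on walks letterwise, and can be used for sets of at most \<open>k\<close> walks when
  \<open>r k \<le> m\<close>. Every passage to the arc graph decreases the chromatic number at most
  logarithmically, so the walks over a large alphabet are not \<open>d\<close>-colourable, while the walks of
  length \<open>r\<close> over an alphabet whose size is exponential in \<open>r\<close> are still 3-colourable.
\<close>

section \<open>Uniformly random injections\<close>

definition injections :: "'s set \<Rightarrow> 't set \<Rightarrow> ('s \<Rightarrow> 't) set" where
  "injections S T = {g \<in> S \<rightarrow>\<^sub>E T. inj_on g S}"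

lemma finite_injections: "finite S \<Longrightarrow> finite T \<Longrightarrow> finite (injections S T)"
  by (simp add: injections_def finite_PiE)

text \<open>An injection on \<open>S\<close> extends to \<open>a\<close> by any value of
  \<open>T\<close> outside its image. The number of such values is the same for all injections, so
  the condition \<open>P\<close> on the restriction survives as a common factor.\<close>

lemma card_injections_insert:
  assumes "finite S" "finite T" "a \<notin> S"
  shows "card {g \<in> injections (insert a S) T. P (restrict g S)} =
    (card T - card S) * card {g \<in> injections S T. P g}"
proof -
  let ?D = "Sigma {g \<in> injections S T. P g} (\<lambda>g. T - g ` S)"
  let ?ext = "\<lambda>(g, t). g(a := t)"
  have restr: "restrict (g(a := t)) S = g" if "g \<in> extensional S" for g :: "'a \<Rightarrow> 'b" and t
    using that \<open>a \<notin> S\<close> by (auto simp: fun_eq_iff restrict_def extensional_def)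
  have "bij_betw ?ext ?D {g \<in> injections (insert a S) T. P (restrict g S)}"
  proof (rule bij_betwI[where g = "\<lambda>g. (restrict g S, g a)"])
    show "?ext \<in> ?D \<rightarrow> {g \<in> injections (insert a S) T. P (restrict g S)}"
      using \<open>a \<notin> S\<close>
      by (auto simp: injections_def restr PiE_iff extensional_def inj_on_fun_updI split: if_splits)
    show "(\<lambda>g. (restrict g S, g a)) \<in> {g \<in> injections (insert a S) T. P (restrict g S)} \<rightarrow> ?D"
      using \<open>a \<notin> S\<close> by (auto simp: injections_def PiE_iff inj_on_def)
    show "(restrict (?ext p) S, ?ext p a) = p" if "p \<in> ?D" for p
      using that by (auto simp: injections_def restr PiE_iff)
    show "?ext (restrict g S, g a) = g"
      if "g \<in> {g \<in> injections (insert a S) T. P (restrict g S)}" for g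
      using that by (auto simp: injections_def PiE_iff fun_eq_iff extensional_def restrict_def)
  qed
  then have "card {g \<in> injections (insert a S) T. P (restrict g S)} = card ?D"
    by (rule bij_betw_same_card[symmetric])
  also have "\<dots> = (\<Sum>g\<in>{g \<in> injections S T. P g}. card (T - g ` S))"
    using assms by (simp add: card_SigmaI finite_injections)
  also have "\<dots> = (\<Sum>g\<in>{g \<in> injections S T. P g}. card T - card S)"
  proof (rule sum.cong)
    fix g assume "g \<in> {g \<in> injections S T. P g}"
    then have "g ` S \<subseteq> T" "card (g ` S) = card S"
      by (auto simp: injections_def card_image)
    then show "card (T - g ` S) = card T - card S"
      using \<open>finite S\<close> by (simp add: card_Diff_subset)
  qed simp
  finally show ?thesis by simp
qed

lemma card_injections_pos:
  assumes "finite S" "finite T" "card S \<le> card T"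
  shows "0 < card (injections S T)"
proof -
  obtain g where "g ` S \<subseteq> T" "inj_on g S"
    using card_le_inj[OF assms] by auto
  then have "restrict g S \<in> injections S T"
    by (auto simp: injections_def inj_on_restrict_eq)
  then show ?thesis
    using assms finite_injections[of S T] by (auto simp: card_gt_0_iff)
qed

definition inj_prob :: "'s set \<Rightarrow> 't set \<Rightarrow> (('s \<Rightarrow> 't) \<Rightarrow> bool) \<Rightarrow> real" where
  "inj_prob S T P = real (card {g \<in> injections S T. P g}) / real (card (injections S T))"

lemma inj_prob_bounds:
  assumes "finite S" "finite T"
  shows "0 \<le> inj_prob S T P" "inj_prob S T P \<le> 1"
proof -
  have "card {g \<in> injections S T. P g} \<le> card (injections S T)"
    using assms by (intro card_mono finite_injections) auto
  then show "inj_prob S T P \<le> 1"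
    by (auto simp: inj_prob_def divide_le_eq_1)
qed (simp add: inj_prob_def)

lemma inj_prob_eq_1:
  assumes "finite S" "finite T" "card S \<le> card T" "\<And>g. g \<in> injections S T \<Longrightarrow> P g"
  shows "inj_prob S T P = 1"
proof -
  have "{g \<in> injections S T. P g} = injections S T"
    using assms(4) by auto
  then show ?thesis
    using card_injections_pos[OF assms(1-3)] by (simp add: inj_prob_def)
qed

lemma inj_prob_eq_0:
  assumes "\<And>g. g \<in> injections S T \<Longrightarrow> \<not> P g"
  shows "inj_prob S T P = 0"
proof -
  have "{g \<in> injections S T. P g} = {}"
    using assms by auto
  then show ?thesis by (simp only: inj_prob_def card.empty of_nat_0 div_0)
qed

lemma inj_prob_cong:
  assumes "\<And>g. g \<in> injections S T \<Longrightarrow> P g \<longleftrightarrow> Q g"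
  shows "inj_prob S T P = inj_prob S T Q"
proof -
  have "{g \<in> injections S T. P g} = {g \<in> injections S T. Q g}"
    using assms by auto
  then show ?thesis by (simp add: inj_prob_def)
qed

lemma inj_prob_sum:
  assumes "finite S" "finite T" "finite H"
  shows "(\<Sum>h\<in>H. inj_prob S T (\<lambda>g. F g = h)) = inj_prob S T (\<lambda>g. F g \<in> H)"
proof -
  have "{g \<in> injections S T. F g \<in> H} = (\<Union>h\<in>H. {g \<in> injections S T. F g = h})"
    by auto
  then have "card {g \<in> injections S T. F g \<in> H} = (\<Sum>h\<in>H. card {g \<in> injections S T. F g = h})"
    using assms by (auto simp: finite_injections intro!: card_UN_disjoint)
  then show ?thesis
    by (simp add: inj_prob_def sum_divide_distrib)
qed

text \<open>Adding one point to the domain multiplies the numbers of favourable and of all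
  injections by the same factor, which is positive as long as \<open>T\<close> has room. This
  consistency of marginals yields SA2 and SA3.\<close>

lemma inj_prob_restrict:
  assumes "finite S'" "finite T" "S \<subseteq> S'" "card S' \<le> card T"
  shows "inj_prob S' T (\<lambda>g. P (restrict g S)) = inj_prob S T P"
proof -
  let ?Q = "\<lambda>g. P (restrict g S)"
  have "finite S"
    using assms finite_subset by blast
  have "inj_prob (S \<union> D) T ?Q = inj_prob S T P"
    if "finite D" "D \<inter> S = {}" "card (S \<union> D) \<le> card T" for D
    using that
  proof (induction D rule: finite_induct)
    case empty
    have "restrict g S = g" if "g \<in> injections S T" for g
      using that by (auto simp: injections_def PiE_def extensional_restrict)
    then show ?case
      unfolding Un_empty_right by (intro inj_prob_cong) simp
  next
    case (insert a D)
    let ?S = "S \<union> D"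
    have a: "finite ?S" "a \<notin> ?S" and le: "card ?S < card T"
      using insert \<open>finite S\<close> by auto
    have "restrict (restrict g ?S) S = restrict g S" for g :: "'a \<Rightarrow> 'b"
      by (simp add: inf.absorb2)
    then have "card {g \<in> injections (insert a ?S) T. ?Q g} =
        (card T - card ?S) * card {g \<in> injections ?S T. ?Q g}"
      using card_injections_insert[of ?S T a ?Q] a \<open>finite T\<close> by simp
    moreover have "card (injections (insert a ?S) T) =
        (card T - card ?S) * card (injections ?S T)"
      using card_injections_insert[of ?S T a "\<lambda>_. True"] a \<open>finite T\<close> by simp
    ultimately have "inj_prob (insert a ?S) T ?Q = inj_prob ?S T ?Q"
      using le by (simp add: inj_prob_def)
    also have "\<dots> = inj_prob S T P"
      using insert le by (intro insert.IH) auto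
    finally show ?case
      unfolding Un_insert_right .
  qed
  moreover have "S \<union> (S' - S) = S'"
    using assms(3) by blast
  ultimately show ?thesis
    using assms(1,4) by (metis Diff_disjoint finite_Diff inf_commute)
qed

section \<open>Solutions from random injections\<close>

text \<open>The constraints at level \<open>k\<close> are among those at level \<open>k'\<close>.
  This lets the level be raised to at least the arity 2.\<close>

lemma sa_accepts_mono:
  assumes "sa_accepts \<sigma> k' \<X> \<A>" "k \<le> k'"
  shows "sa_accepts \<sigma> k \<X> \<A>"
proof -
  obtain lv lr where *: "sa_solution \<sigma> k' \<X> \<A> lv lr"
    using assms(1) by (auto simp: sa_accepts_def)
  have le: "n \<le> k'" if "n \<le> k" for n
    using that assms(2) by (rule le_trans)
  have "sa_solution \<sigma> k \<X> \<A> lv lr"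
    unfolding sa_solution_def
  proof (intro conjI)
  qed (use * le in \<open>simp_all add: sa_solution_def\<close>)
  then show ?thesis by (auto simp: sa_accepts_def)
qed

text \<open>The value \<open>col v g\<close> is the label of the vertex \<open>v\<close> under the random injection \<open>g\<close>.\<close>

lemma sa_accepts_random_injection:
  fixes \<X> :: "('r, 'x) rel_structure" and \<A> :: "('r, 'a) rel_structure"
    and b :: "'x \<Rightarrow> 's set" and col :: "'x \<Rightarrow> ('s \<Rightarrow> 't) \<Rightarrow> 'a"
  assumes "finite T" "finite (domain \<A>)" and struct: "is_finite_structure \<sigma> \<X>"
    and arity: "\<And>R. R \<in> syms \<sigma> \<Longrightarrow> arity \<sigma> R \<le> k"
    and fin: "\<And>v. v \<in> domain \<X> \<Longrightarrow> finite (b v)"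
    and size: "\<And>v. v \<in> domain \<X> \<Longrightarrow> card (b v) \<le> r" "k * r \<le> card T"
    and local: "\<And>v g g'. v \<in> domain \<X> \<Longrightarrow> (\<And>s. s \<in> b v \<Longrightarrow> g s = g' s) \<Longrightarrow> col v g = col v g'"
    and col: "\<And>v g. v \<in> domain \<X> \<Longrightarrow> g \<in> b v \<rightarrow> T \<Longrightarrow> inj_on g (b v) \<Longrightarrow> col v g \<in> domain \<A>"
    and hom: "\<And>R x g. R \<in> syms \<sigma> \<Longrightarrow> x \<in> rel \<X> R \<Longrightarrow> g \<in> injections (\<Union>(b ` set x)) T \<Longrightarrow>
      map (\<lambda>v. col v g) x \<in> rel \<A> R"
  shows "sa_accepts \<sigma> k \<X> \<A>"
proof -
  define B where "B V = \<Union>(b ` V)" for V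
  define F where "F V g = restrict (\<lambda>v. col v g) V" for V g
  \<comment> \<open>The joint distribution of the labels of \<open>V\<close>. The injection is
    defined only on the points that \<open>V\<close> involves, of which there are at most
    \<open>k * r\<close>.\<close>
  define lv where "lv V f = inj_prob (B V) T (\<lambda>g. F V g = f)" for V f
  have finB: "finite (B V)" if "finite V" "V \<subseteq> domain \<X>" for V
    using that fin by (auto simp: B_def)
  have cardB: "card (B V) \<le> card T" if "finite V" "V \<subseteq> domain \<X>" "card V \<le> k" for V
  proof -
    have "card (B V) \<le> (\<Sum>v\<in>V. card (b v))"
      unfolding B_def using that(1) by (rule card_UN_le)
    also have "\<dots> \<le> card V * r"
      using that size by (intro sum_bounded_above[THEN order_trans]) auto
    also have "\<dots> \<le> card T"
      using that size by (meson mult_le_mono1 order_trans)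
    finally show ?thesis .
  qed
  have F: "F V g \<in> V \<rightarrow>\<^sub>E domain \<A>" if "V \<subseteq> domain \<X>" "g \<in> injections (B V) T" for V g
    using that unfolding F_def injections_def B_def
    by (auto intro!: col inj_on_subset[of g "\<Union>(b ` V)"])
  have total: "(\<Sum>f\<in>V \<rightarrow>\<^sub>E domain \<A>. lv V f) = 1"
    if "finite V" "V \<subseteq> domain \<X>" "card V \<le> k" for V
  proof -
    have "(\<Sum>f\<in>V \<rightarrow>\<^sub>E domain \<A>. lv V f) =
        inj_prob (B V) T (\<lambda>g. F V g \<in> V \<rightarrow>\<^sub>E domain \<A>)"
      unfolding lv_def using that assms(1,2) finB by (intro inj_prob_sum finite_PiE) auto
    also have "\<dots> = 1"
      using that assms(1) finB cardB F by (intro inj_prob_eq_1) auto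
    finally show ?thesis .
  qed
  have marginal: "lv U f = (\<Sum>g | g \<in> V \<rightarrow>\<^sub>E domain \<A> \<and> restrict g U = f. lv V g)"
    if "U \<subseteq> V" "finite V" "V \<subseteq> domain \<X>" "card V \<le> k" for U V f
  proof -
    let ?H = "{g \<in> V \<rightarrow>\<^sub>E domain \<A>. restrict g U = f}"
    \<comment> \<open>By locality the labels on \<open>U\<close> depend only on \<open>B U\<close>,
      so the event can be moved from \<open>B V\<close> to \<open>B U\<close>.\<close>
    have "F U (restrict g (B U)) = F U g" for g
      unfolding F_def B_def using that by (intro restrict_ext local) auto
    moreover have "restrict (F V g) U = F U g" for g
      unfolding F_def using that by (simp add: inf.absorb2)
    ultimately have "inj_prob (B V) T (\<lambda>g. F V g \<in> ?H) =
        inj_prob (B V) T (\<lambda>g. F U (restrict g (B U)) = f)"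
      using that F by (intro inj_prob_cong) auto
    also have "\<dots> = lv U f"
      unfolding lv_def using that assms(1) finB cardB
      by (intro inj_prob_restrict) (auto simp: B_def)
    moreover have "finite ?H"
      using that assms(2) by (intro finite_subset[of ?H "V \<rightarrow>\<^sub>E domain \<A>"] finite_PiE) auto
    ultimately show ?thesis
      unfolding lv_def using that assms(1) finB by (subst inj_prob_sum) auto
  qed
  have bounds: "0 \<le> lv V f" "lv V f \<le> 1" if "finite V" "V \<subseteq> domain \<X>" for V f
    unfolding lv_def using that assms(1) finB by (auto intro: inj_prob_bounds)
  have finV: "finite V" if "V \<subseteq> domain \<X>" for V
    using that struct finite_subset by (auto simp: is_finite_structure_def)
  have tuple: "set x \<subseteq> domain \<X>" "card (set x) \<le> k" if "R \<in> syms \<sigma>" "x \<in> rel \<X> R" for R x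
    using that struct arity[of R] card_length[of x]
    by (auto simp: is_finite_structure_def is_structure_def)
  have zero: "lv (set x) f = 0" if "R \<in> syms \<sigma>" "x \<in> rel \<X> R" "map f x \<notin> rel \<A> R" for R x f
    unfolding lv_def
  proof (rule inj_prob_eq_0)
    fix g assume "g \<in> injections (B (set x)) T"
    then have "map (F (set x) g) x \<in> rel \<A> R"
      using hom[OF that(1,2), of g] by (simp add: B_def F_def cong: map_cong)
    with that(3) show "F (set x) g \<noteq> f"
      by auto
  qed
  \<comment> \<open>Tuples have at most \<open>k\<close> distinct entries, so the variables of a
    tuple can be those of its set of entries.\<close>
  have "sa_solution \<sigma> k \<X> \<A> lv (\<lambda>R x. lv (set x))"
    unfolding sa_solution_def
  proof (intro conjI allI impI; (elim conjE)?)
    fix V assume "V \<subseteq> domain \<X>" "card V \<le> k"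
    then show "(\<Sum>f\<in>V \<rightarrow>\<^sub>E domain \<A>. lv V f) = 1"
      by (intro total finV)
  next
    fix U V f assume "U \<subseteq> V" "V \<subseteq> domain \<X>" "card V \<le> k"
    then show "lv U f = (\<Sum>g | g \<in> V \<rightarrow>\<^sub>E domain \<A> \<and> restrict g U = f. lv V g)"
      by (intro marginal finV)
  next
    fix R x U f assume "R \<in> syms \<sigma>" "x \<in> rel \<X> R" "U \<subseteq> set x"
    then show "lv U f = (\<Sum>g | g \<in> set x \<rightarrow>\<^sub>E domain \<A> \<and> restrict g U = f. lv (set x) g)"
      by (intro marginal tuple) auto
  next
    fix R x f assume "R \<in> syms \<sigma>" "x \<in> rel \<X> R" "map f x \<notin> rel \<A> R"
    then show "lv (set x) f = 0"
      by (rule zero)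
  next
    fix V f assume "V \<subseteq> domain \<X>"
    then show "0 \<le> lv V f" "lv V f \<le> 1"
      by (auto intro: bounds finV)
  next
    fix R x f assume "R \<in> syms \<sigma>" "x \<in> rel \<X> R"
    then show "0 \<le> lv (set x) f" "lv (set x) f \<le> 1"
      using bounds[of "set x" f] tuple by auto
  qed
  then show ?thesis by (auto simp: sa_accepts_def)
qed

section \<open>Colouring walks\<close>

text \<open>The arc graph of the graph on \<open>walks r A\<close> is the graph on \<open>walks (Suc r) A\<close>: a walk \<open>z\<close> of
  \<open>r + 1\<close> letters is the arc from \<open>butlast z\<close> to \<open>tl z\<close>.\<close>

definition walks :: "nat \<Rightarrow> 'a set \<Rightarrow> 'a list set" where
  "walks r A = {xs. length xs = r \<and> set xs \<subseteq> A \<and> distinct_adj xs}"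

definition walk_colouring :: "nat \<Rightarrow> 'a set \<Rightarrow> 'c set \<Rightarrow> ('a list \<Rightarrow> 'c) \<Rightarrow> bool" where
  "walk_colouring r A C h \<longleftrightarrow>
     h \<in> walks r A \<rightarrow> C \<and> (\<forall>z\<in>walks (Suc r) A. h (butlast z) \<noteq> h (tl z))"

lemma finite_walks: "finite A \<Longrightarrow> finite (walks r A)"
  by (rule finite_subset[OF _ finite_lists_length_eq[of A r]]) (auto simp: walks_def)

lemma walks_butlast:
  assumes "z \<in> walks (Suc r) A"
  shows "butlast z \<in> walks r A"
  using assms by (auto simp: walks_def distinct_adj_conv_nth nth_butlast dest: in_set_butlastD)

lemma walks_tl:
  assumes "z \<in> walks (Suc r) A"
  shows "tl z \<in> walks r A"
  using assms by (cases z) (auto simp: walks_def dest: distinct_adj_ConsD)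

lemma walks_map:
  assumes "xs \<in> walks r A" "g \<in> set xs \<rightarrow> B" "inj_on g (set xs)"
  shows "map g xs \<in> walks r B"
  using assms by (auto simp: walks_def distinct_adj_conv_nth inj_on_eq_iff)

lemma walk_colouring_recolour:
  assumes "walk_colouring r A C h" "inj_on f C" "f ` C \<subseteq> D"
  shows "walk_colouring r A D (f \<circ> h)"
  unfolding walk_colouring_def
proof (intro conjI ballI funcsetI)
  fix xs assume "xs \<in> walks r A"
  then show "(f \<circ> h) xs \<in> D"
    using assms by (auto simp: walk_colouring_def)
next
  fix z assume z: "z \<in> walks (Suc r) A"
  then have "h (butlast z) \<in> C" "h (tl z) \<in> C" "h (butlast z) \<noteq> h (tl z)"
    using assms(1) walks_butlast[OF z] walks_tl[OF z] by (auto simp: walk_colouring_def)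
  then show "(f \<circ> h) (butlast z) \<noteq> (f \<circ> h) (tl z)"
    using assms(2) by (simp add: inj_on_eq_iff)
qed

text \<open>A vertex is coloured by the set of colours of the arcs leaving it: the colour of an arc
  belongs to the set of its tail but not to the set of its head.\<close>

lemma walk_colouring_Pow:
  assumes "walk_colouring (Suc r) A C h" "0 < r"
  shows "walk_colouring r A (Pow C) (\<lambda>xs. h ` {z \<in> walks (Suc r) A. butlast z = xs})"
  unfolding walk_colouring_def
proof (intro conjI ballI funcsetI notI)
  fix xs assume "xs \<in> walks r A"
  show "h ` {z \<in> walks (Suc r) A. butlast z = xs} \<in> Pow C"
    using assms(1) by (auto simp: walk_colouring_def)
next
  fix z assume z: "z \<in> walks (Suc r) A"
    and eq: "h ` {y \<in> walks (Suc r) A. butlast y = butlast z} =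
      h ` {y \<in> walks (Suc r) A. butlast y = tl z}"
  obtain a b zs where ab: "z = a # b # zs"
    using z \<open>0 < r\<close> by (cases z; cases "tl z") (auto simp: walks_def)
  \<comment> \<open>The colour \<open>h z\<close> lies in the set at \<open>butlast z\<close>, hence
    also in the set at \<open>tl z\<close>: an arc \<open>y\<close> following \<open>z\<close> has
    the same colour.\<close>
  obtain y where y: "y \<in> walks (Suc r) A" "butlast y = tl z" "h z = h y"
    using eq z by blast
  then obtain ys where ys: "y = b # ys" "ys \<noteq> []"
    using ab by (cases y) (auto split: if_splits)
  have "a # y \<in> walks (Suc (Suc r)) A"
    using y z by (auto simp: walks_def ab ys)
  then have "h (butlast (a # y)) \<noteq> h y"
    using assms(1) by (fastforce simp: walk_colouring_def)
  moreover have "butlast (a # y) = z"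
    using y ys ab by simp
  ultimately show False
    using y by simp
qed

text \<open>The dual construction: an arc \<open>(a, b)\<close> receives an element of \<open>X a - X b\<close>, so that consecutive
  arcs receive different elements.\<close>

lemma walk_colouring_antichain:
  assumes "walk_colouring r B C h"
    and X: "\<And>a. a \<in> A \<Longrightarrow> X a \<subseteq> B"
      "\<And>a b. a \<in> A \<Longrightarrow> b \<in> A \<Longrightarrow> a \<noteq> b \<Longrightarrow> \<not> X a \<subseteq> X b"
  shows "\<exists>h'. walk_colouring (Suc r) A C h'"
proof -
  define \<phi> where "\<phi> a b = (SOME i. i \<in> X a - X b)" for a b
  define step where "step xs = map2 \<phi> xs (tl xs)" for xs
  have \<phi>: "\<phi> a b \<in> X a - X b" if "a \<in> A" "b \<in> A" "a \<noteq> b" for a b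
  proof -
    have "\<exists>i. i \<in> X a - X b"
      using X(2)[OF that] by blast
    then show ?thesis
      unfolding \<phi>_def by (rule someI_ex)
  qed
  have len: "length (step xs) = length xs - 1" for xs
    by (simp add: step_def)
  have nth: "step xs ! i = \<phi> (xs ! i) (xs ! Suc i)" if "Suc i < length xs" for xs i
    using that by (simp add: step_def nth_tl)
  have step: "step xs \<in> walks n B" if "xs \<in> walks (Suc n) A" for xs n
  proof -
    have xs: "length xs = Suc n" "\<And>i. i \<le> n \<Longrightarrow> xs ! i \<in> A"
      "\<And>i. i < n \<Longrightarrow> xs ! i \<noteq> xs ! Suc i"
      using that by (auto simp: walks_def distinct_adj_conv_nth)
    then have mem: "step xs ! i \<in> X (xs ! i) - X (xs ! Suc i)" if "i < n" for i
      using that \<phi>[of "xs ! i" "xs ! Suc i"] by (simp add: nth)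
    have "step xs ! i \<in> B" if "i < n" for i
      using that mem[of i] X(1)[of "xs ! i"] xs(2)[of i] by auto
    then have "set (step xs) \<subseteq> B"
      using xs(1) by (auto simp: in_set_conv_nth len)
    moreover have "distinct_adj (step xs)"
      unfolding distinct_adj_conv_nth
    proof (intro allI impI notI)
      fix i assume "Suc i < length (step xs)" and eq: "step xs ! i = step xs ! Suc i"
      then have "Suc i < n"
        using xs(1) by (simp add: len)
      then show False
        using mem[of i] mem[of "Suc i"] eq by simp
    qed
    ultimately show ?thesis
      using xs(1) by (simp add: walks_def len)
  qed
  \<comment> \<open>Hence \<open>step\<close> maps edges to edges, and \<open>h\<close> pulls back
    along it.\<close>
  have "step (butlast z) = butlast (step z)" "step (tl z) = tl (step z)" for z
    by (rule nth_equalityI; simp add: len nth nth_butlast nth_tl)+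
  then have "walk_colouring (Suc r) A C (h \<circ> step)"
    using assms(1) step[of _ r] step[of _ "Suc r"] by (auto simp: walk_colouring_def)
  then show ?thesis by (rule exI[of _ "h \<circ> step"])
qed

section \<open>Lower and upper bounds on the number of colours for walks\<close>

definition walks_colourable :: "nat \<Rightarrow> nat \<Rightarrow> nat \<Rightarrow> bool" where
  "walks_colourable r n p \<longleftrightarrow> (\<exists>h. walk_colouring r {..<n} {..<p} h)"

text \<open>Induction on the length: \<open>p\<close> colours on longer walks would give
  \<open>2 ^ p\<close> colours on walks one letter shorter, so \<open>p\<close> must vary. Walks of
  length 1 form a clique, where pigeonhole applies.\<close>

lemma walks_not_colourable: "\<exists>n. \<not> walks_colourable (Suc r) n p"
proof (induction r arbitrary: p)
  case 0
  have "\<not> walk_colouring (Suc 0) {..<Suc p} {..<p} h" for h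
  proof
    assume h: "walk_colouring (Suc 0) {..<Suc p} {..<p} h"
    have "(\<lambda>a. h [a]) ` {..<Suc p} \<subseteq> {..<p}"
      using h by (auto simp: walk_colouring_def walks_def)
    moreover have "inj_on (\<lambda>a. h [a]) {..<Suc p}"
    proof (rule inj_onI, rule ccontr)
      fix a b assume "a \<in> {..<Suc p}" "b \<in> {..<Suc p}" "h [a] = h [b]" "a \<noteq> b"
      moreover from this have "[a, b] \<in> walks (Suc (Suc 0)) {..<Suc p}"
        by (simp add: walks_def)
      ultimately show False
        using h by (fastforce simp: walk_colouring_def)
    qed
    ultimately show False
      using card_inj_on_le[of "\<lambda>a. h [a]" "{..<Suc p}" "{..<p}"] by simp
  qed
  then show ?case by (auto simp: walks_colourable_def)
next
  case (Suc r)
  obtain n where n: "\<not> walks_colourable (Suc r) n (2 ^ p)"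
    using Suc by blast
  obtain f :: "nat set \<Rightarrow> nat" where f: "f ` Pow {..<p} \<subseteq> {..<2 ^ p}" "inj_on f (Pow {..<p})"
    using card_le_inj[of "Pow {..<p}" "{..<2 ^ p :: nat}"] by (auto simp: card_Pow)
  have "\<not> walks_colourable (Suc (Suc r)) n p"
  proof
    assume "walks_colourable (Suc (Suc r)) n p"
    then obtain h where "walk_colouring (Suc (Suc r)) {..<n} {..<p} h"
      by (auto simp: walks_colourable_def)
    from walk_colouring_recolour[OF walk_colouring_Pow[OF this] f(2,1)]
    show False
      using n by (auto simp: walks_colourable_def)
  qed
  then show ?case ..
qed

text \<open>The two-element subsets of \<open>{..<n}\<close> form an antichain with
  \<open>n choose 2\<close> members.\<close>

lemma walks_colourable_choose_2:
  assumes "walks_colourable r n p" "m \<le> n choose 2"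
  shows "walks_colourable (Suc r) m p"
proof -
  obtain h where h: "walk_colouring r {..<n} {..<p} h"
    using assms(1) by (auto simp: walks_colourable_def)
  let ?F = "{Y. Y \<subseteq> {..<n} \<and> card Y = 2}"
  have "finite ?F" "m \<le> card ?F"
    using assms(2) by (simp_all add: n_subsets)
  then obtain X where X: "X ` {..<m} \<subseteq> ?F" "inj_on X {..<m}"
    using card_le_inj[of "{..<m}" ?F] by auto
  have "\<exists>h'. walk_colouring (Suc r) {..<m} {..<p} h'"
  proof (rule walk_colouring_antichain[OF h])
    show "X a \<subseteq> {..<n}" if "a \<in> {..<m}" for a
      using X(1) that by blast
    show "\<not> X a \<subseteq> X b" if "a \<in> {..<m}" "b \<in> {..<m}" "a \<noteq> b" for a b
    proof
      assume "X a \<subseteq> X b"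
      moreover have "card (X a) = 2" "card (X b) = 2"
        using X(1) that by blast+
      moreover have "finite (X b)"
        using \<open>card (X b) = 2\<close> by (intro card_ge_0_finite) simp
      ultimately have "X a = X b"
        by (intro card_subset_eq) simp_all
      with X(2) that show False
        by (auto dest: inj_onD)
    qed
  qed
  then show ?thesis
    by (simp add: walks_colourable_def)
qed

text \<open>The middle letter \<open>y\<close> of a walk \<open>x y z\<close> is a colour, except that \<open>y = 3\<close> is replaced by a
  colour different from \<open>x\<close> and \<open>z\<close>.\<close>

lemma walks_colourable_3_4_3: "walks_colourable 3 4 3"
proof -
  define pick :: "nat \<Rightarrow> nat \<Rightarrow> nat" where
    "pick x z = (if 0 \<notin> {x, z} then 0 else if 1 \<notin> {x, z} then 1 else 2)" for x z
  define h where "h xs = (if xs ! 1 < 3 then xs ! 1 else pick (xs ! 0) (xs ! 2))" for xs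
  have pick: "pick x z < 3" "pick x z \<noteq> x" "pick x z \<noteq> z" for x z
    by (auto simp: pick_def)
  have "h (butlast w) \<noteq> h (tl w)" if "w \<in> walks (Suc 3) {..<4}" for w
  proof -
    have "length w = Suc (Suc (Suc (Suc 0)))"
      using that by (simp add: walks_def)
    then obtain a b c d where w: "w = [a, b, c, d]"
      by (auto simp: length_Suc_conv)
    have "b < 4" "c < 4" "b \<noteq> c"
      using that by (auto simp: w walks_def)
    \<comment> \<open>At most one of \<open>b\<close> and \<open>c\<close> equals 3, and the colour
      picked in its place avoids the other one.\<close>
    then show ?thesis
      using pick(2)[of b d] pick(3)[of a c] by (auto simp: w h_def)
  qed
  then have "walk_colouring 3 {..<4} {..<3} h"
    by (auto simp: walk_colouring_def h_def pick)
  then show ?thesis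
    by (auto simp: walks_colourable_def)
qed

text \<open>The first step leads from 4 letters to 6. From then on \<open>n choose 2\<close> is at
  least \<open>2 * n\<close>, so each further letter in the walks doubles the alphabet.\<close>

lemma walks_colourable_exponential: "walks_colourable (4 + s) (6 * 2 ^ s) 3"
proof (induction s)
  case 0
  have "(6::nat) \<le> 4 choose 2"
    by (simp add: choose_two)
  then show ?case
    using walks_colourable_choose_2[OF walks_colourable_3_4_3] by (simp add: eval_nat_numeral)
next
  case (Suc s)
  let ?n = "6 * 2 ^ s :: nat"
  have "?n * 4 \<le> ?n * (?n - 1)"
    using one_le_power[of "2 :: nat" s] by (intro mult_le_mono2) linarith
  then have "?n * 4 div 2 \<le> ?n choose 2"
    unfolding choose_two by (rule div_le_mono)
  then show ?case
    using walks_colourable_choose_2[OF Suc] by simp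
qed

section \<open>An accepted instance without a \<open>d\<close>-colouring, for each level\<close>

theorem theorem3p6:
  fixes c d :: nat
  assumes "3 \<le> c" and "c \<le> d"
  shows "\<not> (\<exists>k :: nat. sa_solves_pcsp digraph_sig k (clique c) (clique d))"
proof
  assume "\<exists>k. sa_solves_pcsp digraph_sig k (clique c) (clique d)"
  then obtain k where k: "sa_solves_pcsp digraph_sig k (clique c) (clique d)" ..
  define l where "l = max k 2"
  \<comment> \<open>The alphabet size \<open>m\<close> grows exponentially in \<open>l\<close>,
    while \<open>l * r\<close> is quadratic; the offset 4 and the factor 6 come from the base case
    of \<open>walks_colourable_exponential\<close>.\<close>
  define r where "r = 4 + 2 * l"
  define m :: nat where "m = 6 * 2 ^ (2 * l)"
  have "l * r \<le> 6 * (Suc l * Suc l)"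
    by (simp add: r_def algebra_simps)
  also have "Suc l * Suc l \<le> 2 ^ l * 2 ^ l"
    by (intro mult_le_mono; simp add: Suc_le_eq)
  finally have size: "l * r \<le> m"
    by (simp add: m_def mult_2 power_add)
  obtain h where h: "walk_colouring r {..<m} {..<3 :: nat} h"
    using walks_colourable_exponential[of "2 * l"]
    by (auto simp: walks_colourable_def r_def m_def)
  obtain n where n: "\<not> walks_colourable r n d"
    using walks_not_colourable[of "r - 1" d] by (auto simp: r_def)
  \<comment> \<open>The graph on walks of length \<open>r\<close> over \<open>n\<close> letters,
    with vertices encoded as numbers. Here \<open>n\<close> may far exceed \<open>m\<close>:
    acceptance only involves the letters of \<open>l\<close> walks at a time.\<close>
  define \<X> :: "(unit, nat) rel_structure" where
    "\<X> = \<lparr>domain = list_encode ` walks r {..<n},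
      rel = (\<lambda>_. {[list_encode (butlast z), list_encode (tl z)] | z. z \<in> walks (Suc r) {..<n}})\<rparr>"
  have fin: "is_finite_structure digraph_sig \<X>"
    by (auto simp: is_finite_structure_def is_structure_def digraph_sig_def \<X>_def finite_walks
        walks_butlast walks_tl)
  have "sa_accepts digraph_sig l \<X> (clique c)"
  \<comment> \<open>A walk is labelled by the colour under \<open>h\<close> of its letterwise image;
    \<open>Suc\<close> shifts the colours into \<open>{1..c}\<close>.\<close>
  proof (rule sa_accepts_random_injection[where T = "{..<m}" and r = r
        and b = "\<lambda>v. set (list_decode v)" and col = "\<lambda>v g. Suc (h (map g (list_decode v)))"])
    show "is_finite_structure digraph_sig \<X>" "l * r \<le> card {..<m}"
      using fin size by auto
    show "card (set (list_decode v)) \<le> r" if "v \<in> domain \<X>" for v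
      using that by (auto simp: \<X>_def walks_def card_length)
    show "Suc (h (map g (list_decode v))) = Suc (h (map g' (list_decode v)))"
      if "\<And>s. s \<in> set (list_decode v) \<Longrightarrow> g s = g' s" for v and g g' :: "nat \<Rightarrow> nat"
      using that by (simp cong: map_cong)
    have col: "Suc (h xs) \<in> {1..c}" if "xs \<in> walks r {..<m}" for xs
    proof -
      have "h xs < 3"
        using h that by (auto simp: walk_colouring_def)
      with \<open>3 \<le> c\<close> show ?thesis by simp
    qed
    then show "Suc (h (map g (list_decode v))) \<in> domain (clique c)"
      if "v \<in> domain \<X>" "g \<in> set (list_decode v) \<rightarrow> {..<m}" "inj_on g (set (list_decode v))"
      for v g
      using that walks_map[of "list_decode v" r "{..<n}" g "{..<m}"]
      by (auto simp: \<X>_def clique_def)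
    show "map (\<lambda>v. Suc (h (map g (list_decode v)))) x \<in> rel (clique c) R"
      if x: "x \<in> rel \<X> R" and g: "g \<in> injections (\<Union>v\<in>set x. set (list_decode v)) {..<m}"
      for R x g
    proof -
      obtain z where z: "z \<in> walks (Suc r) {..<n}"
        and x: "x = [list_encode (butlast z), list_encode (tl z)]"
        using x by (auto simp: \<X>_def)
      \<comment> \<open>The two ends of an edge must together contain all letters of
        \<open>z\<close>, so that \<open>g\<close> is injective on \<open>z\<close> and maps it to a
        walk.\<close>
      have "z \<noteq> []" "tl z \<noteq> []"
        using z by (auto simp: walks_def r_def simp flip: length_0_conv)
      then have "set (butlast z) \<union> set (tl z) = set z"
        by (cases z) (auto dest: in_set_butlastD)
      then have "g \<in> set z \<rightarrow> {..<m}" "inj_on g (set z)"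
        using g by (auto simp: x injections_def)
      then have gz: "map g z \<in> walks (Suc r) {..<m}"
        using z by (intro walks_map)
      then have "h (butlast (map g z)) \<noteq> h (tl (map g z))"
        using h by (simp add: walk_colouring_def)
      then show ?thesis
        using col[OF walks_butlast[OF gz]] col[OF walks_tl[OF gz]]
        by (simp add: x clique_def map_butlast map_tl)
    qed
  qed (auto simp: clique_def digraph_sig_def l_def)
  then have "sa_accepts digraph_sig k \<X> (clique c)"
    by (rule sa_accepts_mono) (simp add: l_def)
  with k fin have "hom_exists digraph_sig \<X> (clique d)"
    by (auto simp: sa_solves_pcsp_def)
  then obtain f where f: "is_hom digraph_sig \<X> (clique d) f"
    by (auto simp: hom_exists_def)
  have vertex: "f (list_encode xs) \<in> {1..d}" if "xs \<in> walks r {..<n}" for xs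
    using f that by (auto simp: is_hom_def \<X>_def clique_def)
  have edge: "f (list_encode (butlast z)) \<noteq> f (list_encode (tl z))"
    if "z \<in> walks (Suc r) {..<n}" for z
    using f that by (fastforce simp: is_hom_def \<X>_def clique_def digraph_sig_def)
  \<comment> \<open>A homomorphism to the clique is a colouring by \<open>{1..d}\<close>; shifting
    the colours down contradicts the choice of \<open>n\<close>.\<close>
  have "walk_colouring r {..<n} {1..d} (f \<circ> list_encode)"
    using vertex edge by (auto simp: walk_colouring_def)
  then have "walk_colouring r {..<n} {..<d} ((\<lambda>i. i - 1) \<circ> (f \<circ> list_encode))"
    by (rule walk_colouring_recolour) (auto simp: inj_on_def)
  with n show False
    by (auto simp: walks_colourable_def)
qed

end
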